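(* Fix an integer $m\ge 1$. Then for all sufficiently large $t$, the domination polynomial of the tree $W_{m,t}$ has at least $m$ log-concavity failures. More precisely, writing $\gamma=\gamma(W_{m,t})$ and \[ D(W_{m,t};x)=\sum_{s\ge\gamma}d_s x^s , \] for every $j=0,1,\ldots,m-1$ one has \[ d_{\gamma+2j+1}^2<d_{\gamma+2j}\,d_{\gamma+2j+2} \] for all sufficiently large $t$.
   Context: A dominating set of a finite graph $G$ is a set $S$ of vertices such that every vertex is in $S$ or adjacent to a vertex of $S$; $d_s(G)$ is the number of dominating sets of cardinality $s$ (here $d_s=d_s(W_{m,t})$), $D(G;x)=\sum_s d_s(G)x^s$ is the domination polynomial, and $\gamma(G)$ is the cardinality of a smallest dominating set. A log-concavity failure is an index $s$ with $d_s^2<d_{s-1}d_{s+1}$. For positive integers $m,t$, rooted trees are defined as follows (attaching a rooted tree as a child means joining its root by an edge to the parent): - $L$ is the path on three vertices $u,v,w$ (edges $uv$, $vw$), rooted at $u$. - $F_t$ has a root $c$ with $t$ children, each (the root of) a copy of $L$. - $H_t$ has a root with three children, each a copy of $F_t$. - $X$ is the path on two vertices $a,b$, rooted at $a$. - $W_{m,t}$ has a root $r$ with $m$ children each a copy of $H_t$, and one additional child which is a copy of $X$. *)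

theory Defs
  imports "HOL-Computational_Algebra.Polynomial"
begin

text \<open>A graph is a pair of a vertex set and a set of edges, an edge being the
  two-element set of its endpoints.\<close>

type_synonym 'a graph = "'a set \<times> 'a set set"

abbreviation verts :: "'a graph \<Rightarrow> 'a set" where "verts \<equiv> fst"
abbreviation edges :: "'a graph \<Rightarrow> 'a set set" where "edges \<equiv> snd"

definition dominating_set :: "'a graph \<Rightarrow> 'a set \<Rightarrow> bool" where
  "dominating_set G S \<longleftrightarrow>
     S \<subseteq> verts G \<and> (\<forall>v\<in>verts G. v \<in> S \<or> (\<exists>u\<in>S. {u, v} \<in> edges G))"

definition dom_count :: "'a graph \<Rightarrow> nat \<Rightarrow> nat" where
  "dom_count G s = card {S. dominating_set G S \<and> card S = s}"

definition dom_poly :: "'a graph \<Rightarrow> int poly" where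
  "dom_poly G = (\<Sum>s\<le>card (verts G). monom (int (dom_count G s)) s)"

definition dom_number :: "'a graph \<Rightarrow> nat" where
  "dom_number G = Min (card ` {S. dominating_set G S})"

text \<open>The index \<open>0\<close> has no predecessor and is excluded, since \<open>0 - 1 = 0\<close> on naturals.\<close>

definition lc_failure :: "(nat \<Rightarrow> int) \<Rightarrow> nat \<Rightarrow> bool" where
  "lc_failure a s \<longleftrightarrow> s \<ge> 1 \<and> (a s)\<^sup>2 < a (s - 1) * a (s + 1)"

datatype rtree = Node "rtree list"

lemma size_nth_rtree [termination_simp]:
  "i < length ts \<Longrightarrow> size (ts ! i :: rtree) < Suc (size_list size ts)"
  by (metis less_Suc_eq_le nth_mem order_refl size_list_estimation')

text \<open>The vertices of a rooted tree are addressed by paths from the root: the root is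
  \<open>[]\<close>, and \<open>i # p\<close> is the vertex \<open>p\<close> of the \<open>i\<close>-th child.\<close>

fun tree_verts :: "rtree \<Rightarrow> nat list set" where
  "tree_verts (Node ts) = insert [] (\<Union>i<length ts. (#) i ` tree_verts (ts ! i))"

fun tree_edges :: "rtree \<Rightarrow> nat list set set" where
  "tree_edges (Node ts) =
     (\<Union>i<length ts. insert {[], [i]} ((\<lambda>e. (#) i ` e) ` tree_edges (ts ! i)))"

definition tree_graph :: "rtree \<Rightarrow> nat list graph" where
  "tree_graph T = (tree_verts T, tree_edges T)"

lemma tree_graph_simple:
  "finite (verts (tree_graph T))"
  "\<forall>e\<in>edges (tree_graph T). e \<subseteq> verts (tree_graph T) \<and> card e = 2"
proof -
  have root: "[] \<in> tree_verts T" for T by (cases T) simp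
  have "finite (tree_verts T) \<and> (\<forall>e\<in>tree_edges T. e \<subseteq> tree_verts T \<and> card e = 2)"
  proof (induction T)
    case (Node ts)
    have IH: "finite (tree_verts (ts ! i)) \<and>
        (\<forall>e\<in>tree_edges (ts ! i). e \<subseteq> tree_verts (ts ! i) \<and> card e = 2)"
      if "i < length ts" for i using Node[OF nth_mem[OF that]] .
    show ?case
    proof (intro conjI ballI)
      show "finite (tree_verts (Node ts))" using IH by auto
    next
      fix e assume "e \<in> tree_edges (Node ts)"
      then obtain i where i: "i < length ts"
        and "e = {[], [i]} \<or> (\<exists>e'\<in>tree_edges (ts ! i). e = (#) i ` e')" by auto
      then consider "e = {[], [i]}" | e' where "e' \<in> tree_edges (ts ! i)" "e = (#) i ` e'" by blast
      then have "e \<subseteq> tree_verts (Node ts) \<and> card e = 2"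
      proof cases
        case 1
        have "[i] \<in> (#) i ` tree_verts (ts ! i)" using root by blast
        then show ?thesis using 1 i by auto
      next
        case 2
        have "e' \<subseteq> tree_verts (ts ! i)" "card e' = 2" using IH[OF i] 2(1) by auto
        then show ?thesis using 2(2) i by (auto simp: card_image)
      qed
      then show "e \<subseteq> tree_verts (Node ts)" "card e = 2" by auto
    qed
  qed
  then show "finite (verts (tree_graph T))"
    "\<forall>e\<in>edges (tree_graph T). e \<subseteq> verts (tree_graph T) \<and> card e = 2"
    by (simp_all add: tree_graph_def)
qed

definition L_tree :: rtree where
  "L_tree = Node [Node [Node []]]"

definition F_tree :: "nat \<Rightarrow> rtree" where
  "F_tree t = Node (replicate t L_tree)"

definition H_tree :: "nat \<Rightarrow> rtree" where
  "H_tree t = Node (replicate 3 (F_tree t))"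

definition X_tree :: rtree where
  "X_tree = Node [Node []]"

definition W_tree :: "nat \<Rightarrow> nat \<Rightarrow> rtree" where
  "W_tree m t = Node (replicate m (H_tree t) @ [X_tree])"

abbreviation W :: "nat \<Rightarrow> nat \<Rightarrow> nat list graph" where
  "W m t \<equiv> tree_graph (W_tree m t)"

end

theory Submission
  imports Defs "HOL-Library.FuncSet" "HOL-Real_Asymp.Real_Asymp"
begin

text \<open>Every dominating set of \<open>W m t\<close> meets the last edge of the copy of \<open>X\<close> and of each of the
  \<open>3 * m * t\<close> copies of \<open>L\<close>, which forces a large power of the variable into the domination
  polynomial. What remains is governed, with \<open>N = 2 ^ t\<close>, by the centres, the roots of the
  copies of \<open>F\<close>: choosing a centre costs one vertex, but then each of its \<open>t\<close> copies of \<open>L\<close> can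
  be completed minimally in two ways instead of one, a gain of a factor \<open>N\<close>. If some centre of a copy
  of \<open>H\<close> is not chosen, it has to be dominated, by the root of \<open>H\<close> or by additional vertices, and
  this costs at least one more vertex without any gain beyond factors polynomial in \<open>t\<close>.
  Up to such factors and terms of higher order, \<open>H\<close> therefore contributes
  \<open>x * (1 + N * x + N\<^sup>2 * x\<^sup>2) + N ^ 3 * x ^ 3\<close>, in which
  \<open>x + N ^ 3 * x ^ 3\<close> dominates at the scale \<open>x = y * N powr (- 3 / 2)\<close>. Each copy of \<open>H\<close>
  contains, in effect, either one vertex beyond the forced ones or, with weight \<open>N ^ 3\<close>, three of
  them. So at the critical scale only even excesses over the domination number survive, and
  they do so up to excess \<open>2 * m\<close>.

  The proof makes this exact. Generating polynomials of three kinds of vertex sets satisfy a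
  recursion over rooted trees, and solving it for \<open>W m t\<close> gives
  \<open>\<X> ^ ((3 * t + 1) * m + 1) * W_dom m t\<close> (lemma \<open>poly_W_tree\<close>). Let \<open>a i\<close> be the \<open>i\<close>-th coefficient
  of \<open>W_dom m t\<close> and \<open>z = 2 powr (- 3 / 2 * t)\<close>, so that \<open>z\<^sup>2 * 8 ^ t = 1\<close>.

  \<^item> A coefficientwise comparison yields \<open>a (2 * j) \<ge> 8 ^ (t * j)\<close> for \<open>j \<le> m\<close>, that is,
    \<open>a (2 * j) * z ^ (2 * j) \<ge> 1\<close> (lemma \<open>coeff_W_dom_even\<close>). The case \<open>j = 0\<close> also identifies the
    domination number.
  \<^item> As all \<open>a i\<close> are nonnegative, every odd term \<open>a i * z ^ i\<close> is at most half of
    \<open>poly (W_dom m t) z - poly (W_dom m t) (- z)\<close>. Both values tend to \<open>2 * 2 ^ m - 1\<close>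
    (lemma \<open>poly_W_dom_tendsto\<close>), so the odd terms are eventually less than \<open>1\<close>.

  Multiplying the desired inequality by \<open>z ^ (4 * j + 2)\<close> shows that these two facts imply it.\<close>

section \<open>Dominating sets of rooted trees and their branches\<close>

definition dominates_in :: "rtree \<Rightarrow> nat list set \<Rightarrow> nat list \<Rightarrow> bool" where
  "dominates_in T S v \<longleftrightarrow> v \<in> S \<or> (\<exists>u\<in>S. {u, v} \<in> tree_edges T)"

text \<open>Three families suffice for a recursion. If the root of a tree is not chosen, it is of no use to
  its children, which must be dominated within their own branches; if it is chosen, it dominates
  them, and only the rest of each branch remains to be dominated. A root outside the set fails to be
  dominated exactly when none of its children is chosen.\<close>

definition near_dominating :: "rtree \<Rightarrow> nat list set set" where
  "near_dominating T = {S. S \<subseteq> tree_verts T \<and> (\<forall>v\<in>tree_verts T. v \<noteq> [] \<longrightarrow> dominates_in T S v)}"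

definition dominating :: "rtree \<Rightarrow> nat list set set" where
  "dominating T = {S \<in> near_dominating T. dominates_in T S []}"

definition rootless_dominating :: "rtree \<Rightarrow> nat list set set" where
  "rootless_dominating T = {S \<in> dominating T. [] \<notin> S}"

text \<open>The families are related through the trace of a vertex set on each child: a set without the
  root is the same thing as an independent choice of one trace per child.\<close>

definition branch :: "nat \<Rightarrow> nat list set \<Rightarrow> nat list set" where
  "branch i S = {p. i # p \<in> S}"

definition branching :: "nat \<Rightarrow> (nat \<Rightarrow> nat list set set) \<Rightarrow> nat list set set" where
  "branching n \<A> = {S. S \<subseteq> (\<Union>i<n. range ((#) i)) \<and> (\<forall>i<n. branch i S \<in> \<A> i)}"

lemma finite_tree_verts: "finite (tree_verts T)"
  using tree_graph_simple(1)[of T] by (simp add: tree_graph_def)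

lemma root_in_tree_verts [simp]: "[] \<in> tree_verts T"
  by (cases T) simp

lemma dominating_subset: "dominating T \<subseteq> near_dominating T"
  and rootless_dominating_subset: "rootless_dominating T \<subseteq> dominating T"
  by (auto simp: dominating_def rootless_dominating_def)

lemma mem_tree_verts_Cons [simp]:
  "i # p \<in> tree_verts (Node ts) \<longleftrightarrow> i < length ts \<and> p \<in> tree_verts (ts ! i)"
  by auto

lemma mem_tree_edges_Node:
  "e \<in> tree_edges (Node ts) \<longleftrightarrow>
     (\<exists>k<length ts. e = {[], [k]} \<or> (\<exists>e'\<in>tree_edges (ts ! k). e = (#) k ` e'))"
  unfolding tree_edges.simps by blast

lemma doubleton_eq_image_Cons:
  "{i # p, j # q} = (#) k ` e \<longleftrightarrow> i = k \<and> j = k \<and> e = {p, q}"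
proof
  assume eq: "{i # p, j # q} = (#) k ` e"
  then have "i # p \<in> (#) k ` e" "j # q \<in> (#) k ` e" by blast+
  then have k: "i = k" "j = k" by auto
  have "(#) k ` {p, q} = (#) k ` e" using eq k by simp
  then have "{p, q} = e" by (rule inj_image_eq_iff[THEN iffD1, rotated]) (simp add: inj_on_def)
  then show "i = k \<and> j = k \<and> e = {p, q}" using k by simp
qed auto

lemma tree_edges_Cons_Cons [simp]:
  "{i # p, j # q} \<in> tree_edges (Node ts) \<longleftrightarrow> i = j \<and> i < length ts \<and> {p, q} \<in> tree_edges (ts ! i)"
proof -
  have "{i # p, j # q} \<noteq> {[], [k]}" for k by (simp add: doubleton_eq_iff)
  then show ?thesis
    by (simp only: mem_tree_edges_Node doubleton_eq_image_Cons) blast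
qed

lemma tree_edges_Nil_Cons [simp]:
  "{[], i # p} \<in> tree_edges (Node ts) \<longleftrightarrow> i < length ts \<and> p = []"
  "{i # p, []} \<in> tree_edges (Node ts) \<longleftrightarrow> i < length ts \<and> p = []"
proof -
  have "{[], i # p} \<noteq> (#) k ` e" for k e by auto
  moreover have "{[], i # p} = {[], [k]} \<longleftrightarrow> i = k \<and> p = []" for k
    by (auto simp: doubleton_eq_iff)
  ultimately show "{[], i # p} \<in> tree_edges (Node ts) \<longleftrightarrow> i < length ts \<and> p = []"
    by (simp add: mem_tree_edges_Node del: tree_edges.simps)
  then show "{i # p, []} \<in> tree_edges (Node ts) \<longleftrightarrow> i < length ts \<and> p = []"
    by (simp add: insert_commute)
qed

lemma tree_edges_Nil_Nil [simp]: "{[]} \<notin> tree_edges T"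
proof
  assume "{[]} \<in> tree_edges T"
  then have "card {[] :: nat list} = 2"
    using tree_graph_simple(2)[of T] by (simp only: tree_graph_def snd_conv)
  then show False by simp
qed

declare tree_verts.simps [simp del] tree_edges.simps [simp del]

lemma dominates_in_branch:
  assumes "i < length ts"
  shows "dominates_in (Node ts) S (i # p) \<longleftrightarrow>
    dominates_in (ts ! i) (branch i S) p \<or> (p = [] \<and> [] \<in> S)"
proof -
  have "(\<exists>u\<in>S. {u, i # p} \<in> tree_edges (Node ts)) \<longleftrightarrow>
     (\<exists>q. i # q \<in> S \<and> {q, p} \<in> tree_edges (ts ! i)) \<or> (p = [] \<and> [] \<in> S)" (is "?l \<longleftrightarrow> ?r")
  proof
    assume ?l
    then obtain u where "u \<in> S" "{u, i # p} \<in> tree_edges (Node ts)" by blast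
    then show ?r by (cases u) auto
  next
    assume ?r
    then show ?l
      by (metis assms tree_edges_Cons_Cons tree_edges_Nil_Cons(1))
  qed
  then show ?thesis by (simp only: dominates_in_def branch_def mem_Collect_eq Bex_def disj_assoc)
qed

lemma dominates_in_root:
  "dominates_in (Node ts) S [] \<longleftrightarrow> [] \<in> S \<or> (\<exists>i<length ts. [] \<in> branch i S)"
proof -
  have "(\<exists>u\<in>S. {u, []} \<in> tree_edges (Node ts)) \<longleftrightarrow> (\<exists>i<length ts. [] \<in> branch i S)" (is "?l \<longleftrightarrow> ?r")
  proof
    assume ?l
    then obtain u where "u \<in> S" "{u, []} \<in> tree_edges (Node ts)" by blast
    then show ?r by (cases u) (auto simp: branch_def)
  next
    assume ?r
    then show ?l by (auto simp: branch_def intro!: bexI[of _ "[_]"])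
  qed
  then show ?thesis by (simp only: dominates_in_def)
qed

lemma subset_tree_verts_Node:
  "S \<subseteq> tree_verts (Node ts) \<longleftrightarrow>
     S - {[]} \<subseteq> (\<Union>i<length ts. range ((#) i)) \<and> (\<forall>i<length ts. branch i S \<subseteq> tree_verts (ts ! i))"
  (is "?l \<longleftrightarrow> ?r")
proof
  assume ?l
  then show ?r by (auto simp: branch_def tree_verts.simps)
next
  assume r: ?r
  show ?l
  proof
    fix v assume "v \<in> S"
    with r show "v \<in> tree_verts (Node ts)"
      by (cases v) (auto simp: branch_def intro: root_in_tree_verts)
  qed
qed

lemma mem_dominating_iff:
  "S \<in> dominating T \<longleftrightarrow> S \<subseteq> tree_verts T \<and> (\<forall>v\<in>tree_verts T. dominates_in T S v)"
  unfolding dominating_def near_dominating_def mem_Collect_eq using root_in_tree_verts[of T] by metis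

text \<open>This is the form in which domination in a branch arises from the whole tree, \<open>r\<close> saying
  whether the parent of the branch is chosen.\<close>

lemma mem_near_or_dominating_iff:
  "S \<in> (if r then near_dominating T else dominating T) \<longleftrightarrow>
     S \<subseteq> tree_verts T \<and> (\<forall>p\<in>tree_verts T. dominates_in T S p \<or> (p = [] \<and> r))"
proof (cases r)
  case True
  then show ?thesis unfolding near_dominating_def by (simp only: if_True mem_Collect_eq) metis
next
  case False
  then show ?thesis by (simp only: if_False mem_dominating_iff simp_thms)
qed

lemma near_dominating_Node_iff:
  "S \<in> near_dominating (Node ts) \<longleftrightarrow>
     S - {[]} \<in> branching (length ts)
       (\<lambda>i. if [] \<in> S then near_dominating (ts ! i) else dominating (ts ! i))"
proof -
  have br: "branch i (S - {[]}) = branch i S" for i by (auto simp: branch_def)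
  have "(\<forall>v\<in>tree_verts (Node ts). v \<noteq> [] \<longrightarrow> dominates_in (Node ts) S v) \<longleftrightarrow>
    (\<forall>i<length ts. \<forall>p\<in>tree_verts (ts ! i). dominates_in (Node ts) S (i # p))" 
    (is "?l \<longleftrightarrow> ?r")
  proof
    assume l: ?l
    show ?r
    proof (intro allI impI ballI)
      fix i p assume "i < length ts" "p \<in> tree_verts (ts ! i)"
      then show "dominates_in (Node ts) S (i # p)" using l[rule_format, of "i # p"] by simp
    qed
  next
    assume r: ?r
    show ?l
    proof (intro ballI impI)
      fix v assume "v \<in> tree_verts (Node ts)" "v \<noteq> []"
      then show "dominates_in (Node ts) S v" using r by (cases v) simp_all
    qed
  qed
  also have "\<dots> \<longleftrightarrow> (\<forall>i<length ts. \<forall>p\<in>tree_verts (ts ! i).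
      dominates_in (ts ! i) (branch i S) p \<or> (p = [] \<and> [] \<in> S))"
    by (simp add: dominates_in_branch)
  finally have dom: "(\<forall>v\<in>tree_verts (Node ts). v \<noteq> [] \<longrightarrow> dominates_in (Node ts) S v) \<longleftrightarrow> \<dots>" .
  have "S \<in> near_dominating (Node ts) \<longleftrightarrow> S - {[]} \<subseteq> (\<Union>i<length ts. range ((#) i)) \<and>
      (\<forall>i<length ts. branch i S \<subseteq> tree_verts (ts ! i) \<and> (\<forall>p\<in>tree_verts (ts ! i).
      dominates_in (ts ! i) (branch i S) p \<or> (p = [] \<and> [] \<in> S)))"
    unfolding near_dominating_def mem_Collect_eq dom subset_tree_verts_Node
    by (simp only: conj_assoc all_conj_distrib imp_conjR)
  also have "\<dots> \<longleftrightarrow> S - {[]} \<in> branching (length ts)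
       (\<lambda>i. if [] \<in> S then near_dominating (ts ! i) else dominating (ts ! i))"
    unfolding branching_def mem_Collect_eq br
    by (simp only: mem_near_or_dominating_iff)
  finally show ?thesis .
qed

lemma Nil_notin_branching: "S \<in> branching n \<A> \<Longrightarrow> [] \<notin> S"
  by (auto simp: branching_def)

lemma near_dominating_Node:
  "near_dominating (Node ts) = insert [] ` branching (length ts) (\<lambda>i. near_dominating (ts ! i)) \<union>
     branching (length ts) (\<lambda>i. dominating (ts ! i))" (is "_ = insert [] ` ?K \<union> ?D")
proof (intro set_eqI iffI)
  fix S assume "S \<in> near_dominating (Node ts)"
  then have S: "S - {[]} \<in> branching (length ts)
       (\<lambda>i. if [] \<in> S then near_dominating (ts ! i) else dominating (ts ! i))"
    by (simp add: near_dominating_Node_iff)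
  show "S \<in> insert [] ` ?K \<union> ?D"
  proof (cases "[] \<in> S")
    case True
    then have "insert [] (S - {[]}) \<in> insert [] ` ?K" using S by (intro imageI) simp
    then show ?thesis using True by (simp add: insert_absorb)
  qed (use S in simp)
next
  fix S assume "S \<in> insert [] ` ?K \<union> ?D"
  then consider S' where "S = insert [] S'" "S' \<in> ?K" | "S \<in> ?D" by blast
  then show "S \<in> near_dominating (Node ts)"
  proof cases
    case 1
    then have "S - {[]} = S'" using Nil_notin_branching by blast
    then show ?thesis using 1 by (simp add: near_dominating_Node_iff)
  next
    case 2
    then show ?thesis using Nil_notin_branching[OF 2] by (simp add: near_dominating_Node_iff)
  qed
qed

lemma rootless_near_dominating_Node:
  "{S \<in> near_dominating (Node ts). [] \<notin> S} = branching (length ts) (\<lambda>i. dominating (ts ! i))"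
proof -
  have "S - {[]} = S" if "[] \<notin> S" for S :: "nat list set" using that by blast
  then have "S \<in> near_dominating (Node ts) \<longleftrightarrow> S \<in> branching (length ts) (\<lambda>i. dominating (ts ! i))"
    if "[] \<notin> S" for S
    using that by (simp add: near_dominating_Node_iff)
  then show ?thesis using Nil_notin_branching by blast
qed

lemma near_dominating_minus_dominating_Node:
  "near_dominating (Node ts) - dominating (Node ts) =
     branching (length ts) (\<lambda>i. rootless_dominating (ts ! i))"
proof -
  have "S \<in> near_dominating (Node ts) - dominating (Node ts) \<longleftrightarrow>
      S \<in> {S \<in> near_dominating (Node ts). [] \<notin> S} \<and> (\<forall>i<length ts. [] \<notin> branch i S)" for S
    unfolding dominating_def using dominates_in_root[of ts S] by blast
  moreover have "S \<in> {S \<in> near_dominating (Node ts). [] \<notin> S} \<and> (\<forall>i<length ts. [] \<notin> branch i S) \<longleftrightarrow>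
      S \<in> branching (length ts) (\<lambda>i. rootless_dominating (ts ! i))" for S
    unfolding rootless_near_dominating_Node by (auto simp: branching_def rootless_dominating_def)
  ultimately show ?thesis by blast
qed

section \<open>Generating polynomials and their recursion\<close>

definition gf :: "'a set set \<Rightarrow> real poly" where
  "gf \<A> = (\<Sum>S\<in>\<A>. monom 1 (card S))"

lemma coeff_gf: "finite \<A> \<Longrightarrow> coeff (gf \<A>) s = real (card {S \<in> \<A>. card S = s})"
proof -
  assume "finite \<A>"
  have "coeff (gf \<A>) s = (\<Sum>S\<in>\<A>. if card S = s then 1 else 0)"
    by (simp add: gf_def coeff_sum)
  also have "\<dots> = (\<Sum>S\<in>{S \<in> \<A>. card S = s}. 1)"
    using \<open>finite \<A>\<close> by (simp only: sum.inter_filter)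
  finally show ?thesis by simp
qed

lemma gf_Un_disjoint:
  "finite \<A> \<Longrightarrow> finite \<B> \<Longrightarrow> \<A> \<inter> \<B> = {} \<Longrightarrow> gf (\<A> \<union> \<B>) = gf \<A> + gf \<B>"
  by (simp add: gf_def sum.union_disjoint)

lemma gf_Diff: "finite \<A> \<Longrightarrow> \<B> \<subseteq> \<A> \<Longrightarrow> gf (\<A> - \<B>) = gf \<A> - gf \<B>"
  by (simp add: gf_def sum_diff)

lemma bij_betw_branching:
  "bij_betw (\<lambda>f. \<Union>i<n. (#) i ` f i) (Pi\<^sub>E {..<n} \<A>) (branching n \<A>)"
proof (rule bij_betw_byWitness[where f' = "\<lambda>S. \<lambda>i\<in>{..<n}. branch i S"])
  have br: "branch i (\<Union>i<n. (#) i ` f i) = f i" if "i < n" for i f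
    using that by (auto simp: branch_def)
  show "\<forall>f\<in>Pi\<^sub>E {..<n} \<A>. (\<lambda>i\<in>{..<n}. branch i (\<Union>i<n. (#) i ` f i)) = f"
    by (auto simp: fun_eq_iff PiE_def extensional_def br)
  show "\<forall>S\<in>branching n \<A>. (\<Union>i<n. (#) i ` (\<lambda>i\<in>{..<n}. branch i S) i) = S"
    by (fastforce simp: branching_def branch_def)
  show "(\<lambda>f. \<Union>i<n. (#) i ` f i) ` Pi\<^sub>E {..<n} \<A> \<subseteq> branching n \<A>"
    by (auto simp: branching_def br)
  show "(\<lambda>S. \<lambda>i\<in>{..<n}. branch i S) ` branching n \<A> \<subseteq> Pi\<^sub>E {..<n} \<A>"
    by (auto simp: branching_def)
qed

lemma finite_branching:
  assumes "\<And>i. i < n \<Longrightarrow> finite (\<A> i)"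
  shows "finite (branching n \<A>)"
proof -
  have "finite (Pi\<^sub>E {..<n} \<A>)" by (rule finite_PiE) (auto intro: assms)
  then show ?thesis using bij_betw_finite[OF bij_betw_branching[of n \<A>]] by simp
qed

lemma finite_elem_branching:
  assumes "\<And>i S. i < n \<Longrightarrow> S \<in> \<A> i \<Longrightarrow> finite S" "S \<in> branching n \<A>"
  shows "finite S"
proof -
  have "S \<in> (\<lambda>f. \<Union>i<n. (#) i ` f i) ` Pi\<^sub>E {..<n} \<A>"
    using assms(2) by (simp only: bij_betw_imp_surj_on[OF bij_betw_branching])
  then obtain f where "f \<in> Pi\<^sub>E {..<n} \<A>" "S = (\<Union>i<n. (#) i ` f i)" by blast
  moreover have "finite (f i)" if "i < n" for i
    using assms(1)[of i "f i"] \<open>f \<in> _\<close> that by (simp add: PiE_iff)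
  ultimately show ?thesis by simp
qed

text \<open>Choices in different branches are independent and their sizes add up, so generating
  polynomials multiply.\<close>

lemma gf_branching:
  assumes fin: "\<And>i. i < n \<Longrightarrow> finite (\<A> i)" and elem: "\<And>i S. i < n \<Longrightarrow> S \<in> \<A> i \<Longrightarrow> finite S"
  shows "gf (branching n \<A>) = (\<Prod>i<n. gf (\<A> i))"
proof -
  have "gf (branching n \<A>) = (\<Sum>f\<in>Pi\<^sub>E {..<n} \<A>. monom 1 (card (\<Union>i<n. (#) i ` f i)))"
    unfolding gf_def by (rule sum.reindex_bij_betw[OF bij_betw_branching, symmetric])
  also have "\<dots> = (\<Sum>f\<in>Pi\<^sub>E {..<n} \<A>. \<Prod>i<n. monom 1 (card (f i)))"
  proof (rule sum.cong[OF refl])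
    fix f assume "f \<in> Pi\<^sub>E {..<n} \<A>"
    then have "finite (f i)" if "i < n" for i
      using elem[of i "f i"] that by (simp add: PiE_iff)
    then have "card (\<Union>i<n. (#) i ` f i) = (\<Sum>i<n. card ((#) i ` f i))"
      by (intro card_UN_disjoint) auto
    also have "\<dots> = (\<Sum>i<n. card (f i))" by (simp add: card_image)
    finally have *: "card (\<Union>i<n. (#) i ` f i) = (\<Sum>i<n. card (f i))" .
    have "monom (1::real) (a + b) = monom 1 a * monom 1 b" for a b by (simp add: mult_monom)
    then have "monom (1::real) (\<Sum>i<k. card (f i)) = (\<Prod>i<k. monom 1 (card (f i)))" for k
      by (induction k) simp_all
    with * show "monom (1::real) (card (\<Union>i<n. (#) i ` f i)) = (\<Prod>i<n. monom 1 (card (f i)))"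
      by simp
  qed
  also have "\<dots> = (\<Prod>i<n. gf (\<A> i))"
    unfolding gf_def by (rule prod_sum_PiE[symmetric]) (auto intro: fin)
  finally show ?thesis .
qed

definition near_poly :: "rtree \<Rightarrow> real poly" where "near_poly T = gf (near_dominating T)"
definition dominating_poly :: "rtree \<Rightarrow> real poly" where "dominating_poly T = gf (dominating T)"
definition rootless_poly :: "rtree \<Rightarrow> real poly" where "rootless_poly T = gf (rootless_dominating T)"

abbreviation \<X> :: "real poly" where "\<X> \<equiv> [:0, 1:]"

lemma finite_families:
  "finite (near_dominating T)" "finite (dominating T)" "finite (rootless_dominating T)"
  "S \<in> near_dominating T \<Longrightarrow> finite S" "S \<in> dominating T \<Longrightarrow> finite S"
  "S \<in> rootless_dominating T \<Longrightarrow> finite S"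
proof -
  have "near_dominating T \<subseteq> Pow (tree_verts T)" by (auto simp: near_dominating_def)
  then show 1: "finite (near_dominating T)"
    by (rule finite_subset) (simp add: finite_tree_verts)
  show 2: "finite (dominating T)" by (rule finite_subset[OF dominating_subset 1])
  show "finite (rootless_dominating T)" by (rule finite_subset[OF rootless_dominating_subset 2])
  show el: "S \<in> near_dominating T \<Longrightarrow> finite S"
    by (rule finite_subset[OF _ finite_tree_verts[of T]]) (simp add: near_dominating_def)
  show "S \<in> dominating T \<Longrightarrow> finite S" "S \<in> rootless_dominating T \<Longrightarrow> finite S"
    using el dominating_subset rootless_dominating_subset by blast+
qed

lemma gf_branching_nth:
  assumes "\<And>T. finite (\<F> T)" "\<And>S T. S \<in> \<F> T \<Longrightarrow> finite S"
  shows "gf (branching (length ts) (\<lambda>i. \<F> (ts ! i))) = (\<Prod>T\<leftarrow>ts. gf (\<F> T))"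
  by (subst gf_branching) (auto simp: prod.list_conv_set_nth atLeast0LessThan intro: assms)

text \<open>The two summands count the sets with and without the root.\<close>

lemma near_poly_Node:
  "near_poly (Node ts) = \<X> * prod_list (map near_poly ts) + prod_list (map dominating_poly ts)"
proof -
  let ?K = "branching (length ts) (\<lambda>i. near_dominating (ts ! i))"
  let ?D = "branching (length ts) (\<lambda>i. dominating (ts ! i))"
  have inj: "inj_on (insert []) ?K"
    by (rule inj_onI) (metis Nil_notin_branching insert_ident)
  have fin: "finite ?K" "finite ?D" by (auto intro!: finite_branching finite_families)
  have "gf (insert [] ` ?K) = (\<Sum>S\<in>?K. monom 1 (card (insert [] S)))"
    unfolding gf_def by (simp add: sum.reindex[OF inj])
  also have "\<dots> = (\<Sum>S\<in>?K. \<X> * monom 1 (card S))"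
  proof (rule sum.cong[OF refl])
    fix S assume S: "S \<in> ?K"
    have "finite S" by (rule finite_elem_branching[OF _ S]) (rule finite_families)
    then show "monom 1 (card (insert [] S)) = \<X> * monom 1 (card S)"
      using Nil_notin_branching[OF S] by (simp add: monom_Suc)
  qed
  finally have "gf (insert [] ` ?K) = \<X> * gf ?K" by (simp add: gf_def sum_distrib_left)
  moreover have "insert [] ` ?K \<inter> ?D = {}" by (auto dest: Nil_notin_branching)
  ultimately have "near_poly (Node ts) = \<X> * gf ?K + gf ?D"
    unfolding near_poly_def near_dominating_Node by (subst gf_Un_disjoint) (auto simp: fin)
  then show ?thesis
    by (simp add: gf_branching_nth finite_families near_poly_def[abs_def] dominating_poly_def[abs_def])
qed

lemma dominating_poly_Node:
  "dominating_poly (Node ts) = near_poly (Node ts) - prod_list (map rootless_poly ts)"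
proof -
  have "near_poly (Node ts) - dominating_poly (Node ts) =
      gf (near_dominating (Node ts) - dominating (Node ts))"
    by (simp add: near_poly_def dominating_poly_def gf_Diff finite_families dominating_subset)
  also have "\<dots> = prod_list (map rootless_poly ts)"
    by (simp add: near_dominating_minus_dominating_Node gf_branching_nth finite_families
        rootless_poly_def[abs_def])
  finally show ?thesis by (simp add: algebra_simps)
qed

lemma rootless_poly_Node:
  "rootless_poly (Node ts) = prod_list (map dominating_poly ts) - prod_list (map rootless_poly ts)"
proof -
  have "rootless_dominating (Node ts) =
     {S \<in> near_dominating (Node ts). [] \<notin> S} - (near_dominating (Node ts) - dominating (Node ts))"
    by (auto simp: rootless_dominating_def dominating_def)
  also have "gf \<dots> = gf {S \<in> near_dominating (Node ts). [] \<notin> S} -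
      gf (near_dominating (Node ts) - dominating (Node ts))"
  proof (rule gf_Diff)
    show "finite {S \<in> near_dominating (Node ts). [] \<notin> S}"
      using finite_families(1)[of "Node ts"] by simp
    show "near_dominating (Node ts) - dominating (Node ts) \<subseteq> {S \<in> near_dominating (Node ts). [] \<notin> S}"
      by (auto simp: dominating_def dominates_in_def)
  qed
  also have "\<dots> = prod_list (map dominating_poly ts) - prod_list (map rootless_poly ts)"
    by (simp add: rootless_near_dominating_Node near_dominating_minus_dominating_Node
        gf_branching_nth finite_families rootless_poly_def[abs_def] dominating_poly_def[abs_def])
  finally show ?thesis by (simp add: rootless_poly_def)
qed

lemma dominating_set_tree_graph: "dominating_set (tree_graph T) S \<longleftrightarrow> S \<in> dominating T"
proof -
  have "dominating_set (tree_graph T) S \<longleftrightarrow>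
      S \<subseteq> tree_verts T \<and> (\<forall>v\<in>tree_verts T. dominates_in T S v)"
    by (simp add: dominating_set_def tree_graph_def dominates_in_def)
  then show ?thesis by (simp only: mem_dominating_iff)
qed

lemma coeff_dominating_poly: "coeff (dominating_poly T) s = real (dom_count (tree_graph T) s)"
  unfolding dominating_poly_def dom_count_def dominating_set_tree_graph
  by (rule coeff_gf) (rule finite_families)

section \<open>The domination polynomial of W\<close>

text \<open>The generating polynomials of \<open>L\<close>, \<open>H\<close> and \<open>W\<close> are divisible by \<open>\<X>\<close>, \<open>\<X> ^ (3 * t + 1)\<close> and
  \<open>\<X> ^ ((3 * t + 1) * m + 1)\<close> because all sets in the respective families have at least that many
  vertices. The polynomials below are the cofactors; \<open>near\<close>, \<open>dom\<close> and \<open>rootless\<close> refer to the three families.\<close>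

definition L_near :: "real poly" where "L_near = [:2, 3, 1:]"
definition L_dom :: "real poly" where "L_dom = [:1, 3, 1:]"
definition L_rootless :: "real poly" where "L_rootless = [:1, 1:]"

text \<open>The quotient of \<open>L_dom ^ t - L_rootless ^ t\<close> by \<open>\<X>\<close>. Written as a sum, it
  visibly has nonnegative coefficients.\<close>

definition F_rootless :: "nat \<Rightarrow> real poly" where
  "F_rootless t = (\<X> + 2) * (\<Sum>i<t. L_rootless ^ (t - Suc i) * L_dom ^ i)"

lemma X_times_F_rootless: "\<X> * F_rootless t = L_dom ^ t - L_rootless ^ t"
proof -
  have "L_dom - L_rootless = \<X> * (\<X> + 2)" by (simp add: L_dom_def L_rootless_def numeral_poly)
  then show ?thesis by (simp only: F_rootless_def power_diff_sumr2 mult.assoc)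
qed

definition H_near :: "nat \<Rightarrow> real poly" where
  "H_near t = (\<X> * L_near ^ t + L_dom ^ t) ^ 3 + \<X>\<^sup>2 * (L_near ^ t + F_rootless t) ^ 3"

definition H_rootless :: "nat \<Rightarrow> real poly" where
  "H_rootless t = \<X>\<^sup>2 * ((L_near ^ t + F_rootless t) ^ 3 - F_rootless t ^ 3)"

definition H_dom :: "nat \<Rightarrow> real poly" where
  "H_dom t = (\<X> * L_near ^ t + L_dom ^ t) ^ 3 + H_rootless t"

definition W_dom :: "nat \<Rightarrow> nat \<Rightarrow> real poly" where
  "W_dom m t = (\<X> + 2) * (\<X> * H_near t ^ m + H_dom t ^ m) - H_rootless t ^ m"

lemmas poly_Node = dominating_poly_Node near_poly_Node rootless_poly_Node

lemma poly_X_tree: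
  "near_poly X_tree = \<X> * (\<X> + 2)"
  "dominating_poly X_tree = \<X> * (\<X> + 2)"
  "rootless_poly X_tree = \<X>"
  by (simp_all add: X_tree_def poly_Node numeral_poly one_pCons)

lemma poly_L_tree:
  "near_poly L_tree = \<X> * L_near"
  "dominating_poly L_tree = \<X> * L_dom"
  "rootless_poly L_tree = \<X> * L_rootless"
  by (simp_all add: L_tree_def poly_Node numeral_poly one_pCons L_near_def L_dom_def L_rootless_def)

lemma poly_F_tree:
  "near_poly (F_tree t) = \<X> ^ t * (\<X> * L_near ^ t + L_dom ^ t)"
  "dominating_poly (F_tree t) = \<X> ^ t * (\<X> * (L_near ^ t + F_rootless t))"
  "rootless_poly (F_tree t) = \<X> ^ t * (\<X> * F_rootless t)"
proof -
  show near_poly: "near_poly (F_tree t) = \<X> ^ t * (\<X> * L_near ^ t + L_dom ^ t)"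
    by (simp only: F_tree_def near_poly_Node map_replicate prod_list_replicate poly_L_tree
        power_mult_distrib distrib_left mult.left_commute)
  show "rootless_poly (F_tree t) = \<X> ^ t * (\<X> * F_rootless t)"
    by (simp only: F_tree_def rootless_poly_Node map_replicate prod_list_replicate
        poly_L_tree power_mult_distrib right_diff_distrib X_times_F_rootless)
  have "dominating_poly (F_tree t) = near_poly (F_tree t) - \<X> ^ t * L_rootless ^ t"
    by (simp only: F_tree_def dominating_poly_Node map_replicate prod_list_replicate
        poly_L_tree power_mult_distrib)
  also have "\<dots> = \<X> ^ t * (\<X> * L_near ^ t + (L_dom ^ t - L_rootless ^ t))"
    unfolding near_poly by (simp only: distrib_left right_diff_distrib add_diff_eq)
  finally show "dominating_poly (F_tree t) = \<X> ^ t * (\<X> * (L_near ^ t + F_rootless t))"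
    by (simp only: distrib_left X_times_F_rootless)
qed

lemma poly_H_tree:
  "near_poly (H_tree t) = \<X> ^ (3 * t + 1) * H_near t"
  "dominating_poly (H_tree t) = \<X> ^ (3 * t + 1) * H_dom t"
  "rootless_poly (H_tree t) = \<X> ^ (3 * t + 1) * H_rootless t"
proof -
  have ring: "y * (a * k) ^ 3 + (a * (y * d)) ^ 3 = a ^ 3 * y * (k ^ 3 + y\<^sup>2 * d ^ 3)"
    "y * (a * k) ^ 3 + (a * (y * d)) ^ 3 - (a * (y * e)) ^ 3 =
       a ^ 3 * y * (k ^ 3 + y\<^sup>2 * (d ^ 3 - e ^ 3))"
    "(a * (y * d)) ^ 3 - (a * (y * e)) ^ 3 = a ^ 3 * y * (y\<^sup>2 * (d ^ 3 - e ^ 3))"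
    for y a k d e :: "real poly"
    by algebra+
  have pow: "(\<X> ^ t) ^ 3 * \<X> = \<X> ^ (3 * t + 1)"
    by (simp only: power_mult[symmetric] power_add power_one_right mult.commute[of t])
  show "near_poly (H_tree t) = \<X> ^ (3 * t + 1) * H_near t"
    by (simp only: H_tree_def near_poly_Node map_replicate prod_list_replicate poly_F_tree
        ring pow H_near_def)
  show "rootless_poly (H_tree t) = \<X> ^ (3 * t + 1) * H_rootless t"
    by (simp only: H_tree_def rootless_poly_Node map_replicate prod_list_replicate
        poly_F_tree ring pow H_rootless_def)
  show "dominating_poly (H_tree t) = \<X> ^ (3 * t + 1) * H_dom t"
    by (simp only: H_tree_def dominating_poly_Node near_poly_Node map_replicate
        prod_list_replicate poly_F_tree ring(2) pow H_rootless_def H_dom_def)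
qed

lemma poly_W_tree: "dominating_poly (W_tree m t) = \<X> ^ ((3 * t + 1) * m + 1) * W_dom m t"
proof -
  have ring: "y * ((c * k) * (y * z)) + (c * l) * (y * z) - (c * n) * y =
      c * y * (z * (y * k + l) - n)" for y c k l n z :: "real poly"
    by algebra
  have "dominating_poly (W_tree m t) =
      \<X> * ((\<X> ^ (3 * t + 1)) ^ m * H_near t ^ m * (\<X> * (\<X> + 2)))
      + (\<X> ^ (3 * t + 1)) ^ m * H_dom t ^ m * (\<X> * (\<X> + 2))
      - (\<X> ^ (3 * t + 1)) ^ m * H_rootless t ^ m * \<X>"
    by (simp only: W_tree_def dominating_poly_Node near_poly_Node map_append map_replicate
        prod_list_replicate prod_list.append list.map prod_list.Cons prod_list.Nil mult_1_right
        poly_H_tree poly_X_tree power_mult_distrib)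
  then show ?thesis
    unfolding ring W_dom_def power_mult[symmetric] power_Suc2[symmetric] Suc_eq_plus1 .
qed

lemma X_power: "\<X> ^ n = monom 1 n"
  by (simp add: monom_altdef)

section \<open>Lower bounds for the even coefficients\<close>

text \<open>\<open>nonneg_coeffs (p - q)\<close> serves as the coefficientwise comparison of \<open>q\<close> with \<open>p\<close>; the order of
  the polynomial type compares leading coefficients instead.\<close>

definition nonneg_coeffs :: "real poly \<Rightarrow> bool" where
  "nonneg_coeffs p \<longleftrightarrow> (\<forall>i. 0 \<le> coeff p i)"

lemma nonneg_coeffs_add: "nonneg_coeffs p \<Longrightarrow> nonneg_coeffs q \<Longrightarrow> nonneg_coeffs (p + q)"
  by (simp add: nonneg_coeffs_def)

lemma nonneg_coeffs_mult: "nonneg_coeffs p \<Longrightarrow> nonneg_coeffs q \<Longrightarrow> nonneg_coeffs (p * q)"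
  by (simp add: nonneg_coeffs_def coeff_mult sum_nonneg)

lemma nonneg_coeffs_0: "nonneg_coeffs 0"
  by (simp add: nonneg_coeffs_def)

lemma nonneg_coeffs_pCons: "0 \<le> a \<Longrightarrow> nonneg_coeffs p \<Longrightarrow> nonneg_coeffs (pCons a p)"
  by (simp add: nonneg_coeffs_def coeff_pCons split: nat.split)

lemma nonneg_coeffs_const: "nonneg_coeffs 1" "nonneg_coeffs (numeral n)"
  by (simp_all add: one_pCons numeral_poly nonneg_coeffs_pCons nonneg_coeffs_0)

lemma nonneg_coeffs_power: "nonneg_coeffs p \<Longrightarrow> nonneg_coeffs (p ^ n)"
  by (induction n) (auto intro: nonneg_coeffs_mult nonneg_coeffs_const)

lemma nonneg_coeffs_sum: "(\<And>i. i \<in> I \<Longrightarrow> nonneg_coeffs (f i)) \<Longrightarrow> nonneg_coeffs (sum f I)"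
  by (induction I rule: infinite_finite_induct) (auto intro: nonneg_coeffs_add nonneg_coeffs_0)

lemmas nonneg_coeffs_intros = nonneg_coeffs_add nonneg_coeffs_mult nonneg_coeffs_0
  nonneg_coeffs_pCons nonneg_coeffs_const nonneg_coeffs_power nonneg_coeffs_sum

lemma nonneg_coeffs_power_diff:
  assumes "nonneg_coeffs q" "nonneg_coeffs (p - q)"
  shows "nonneg_coeffs (p ^ n - q ^ n)"
proof -
  have "nonneg_coeffs ((p - q) + q)" by (intro nonneg_coeffs_add assms)
  then have p: "nonneg_coeffs p" by simp
  show ?thesis unfolding power_diff_sumr2 by (intro nonneg_coeffs_intros assms p)
qed

lemma nonneg_coeffs_L_F:
  "nonneg_coeffs L_near" "nonneg_coeffs L_dom" "nonneg_coeffs L_rootless"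
  "nonneg_coeffs (F_rootless t)"
  by (auto simp: L_near_def L_dom_def L_rootless_def F_rootless_def intro!: nonneg_coeffs_intros)

lemma nonneg_coeffs_H_rootless: "nonneg_coeffs (H_rootless t)"
proof -
  have "nonneg_coeffs ((L_near ^ t + F_rootless t) ^ 3 - F_rootless t ^ 3)"
    by (rule nonneg_coeffs_power_diff) (auto intro!: nonneg_coeffs_intros nonneg_coeffs_L_F)
  then show ?thesis by (auto simp: H_rootless_def intro!: nonneg_coeffs_intros)
qed

lemma nonneg_coeffs_H: "nonneg_coeffs (H_near t)" "nonneg_coeffs (H_dom t)"
  unfolding H_near_def H_dom_def
  by (intro nonneg_coeffs_intros nonneg_coeffs_L_F nonneg_coeffs_H_rootless; simp)+

text \<open>Among the dominating sets counted by \<open>H_dom\<close> this singles out the cheapest one, with the root of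
  \<open>H\<close> and none of the three centres, and the \<open>8 ^ t\<close> sets with all three centres and
  minimal completions. The power of \<open>[:2:]\<close> is kept in the shape in which it
  is compared with the power of \<open>L_near\<close>.\<close>

lemma nonneg_coeffs_H_dom_minus:
  "nonneg_coeffs (H_dom t - (1 + \<X>\<^sup>2 * ([:2:] ^ t) ^ 3))"
proof -
  let ?p = "L_near ^ t" and ?v = "F_rootless t" and ?c = "[:2:] ^ t :: real poly"
    and ?q = "L_dom ^ t"
  have "L_near - [:2:] = [:0, 3, 1:]" "L_dom - 1 = [:0, 3, 1:]"
    by (simp_all add: L_near_def L_dom_def one_pCons)
  then have PQ: "nonneg_coeffs (L_near - [:2:])" "nonneg_coeffs (L_dom - 1)"
    by (auto intro!: nonneg_coeffs_intros)
  have p: "nonneg_coeffs (?p ^ 3 - ?c ^ 3)"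
    by (intro nonneg_coeffs_power_diff PQ nonneg_coeffs_intros; simp)
  have "nonneg_coeffs (?q - 1 ^ t)"
    by (intro nonneg_coeffs_power_diff PQ nonneg_coeffs_intros)
  then have "nonneg_coeffs (\<X> * ?p + (?q - 1))"
    by (intro nonneg_coeffs_intros nonneg_coeffs_L_F; simp)
  then have "nonneg_coeffs ((\<X> * ?p + ?q) - 1)" by (simp only: add_diff_eq)
  then have "nonneg_coeffs ((\<X> * ?p + ?q) ^ 3 - 1 ^ 3)"
    by (intro nonneg_coeffs_power_diff nonneg_coeffs_intros)
  then have "nonneg_coeffs ((\<X> * ?p + ?q) ^ 3 - 1)" by (simp only: power_one)
  then have "nonneg_coeffs (((\<X> * ?p + ?q) ^ 3 - 1) +
      \<X>\<^sup>2 * ((?p ^ 3 - ?c ^ 3) + 3 * ?p\<^sup>2 * ?v + 3 * ?p * ?v\<^sup>2))"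
    by (intro nonneg_coeffs_intros p nonneg_coeffs_L_F; simp)
  also have "(k ^ 3 - 1) + y\<^sup>2 * ((p ^ 3 - c ^ 3) + 3 * p\<^sup>2 * v + 3 * p * v\<^sup>2) =
      k ^ 3 + y\<^sup>2 * ((p + v) ^ 3 - v ^ 3) - (1 + y\<^sup>2 * c ^ 3)" for k y p c v :: "real poly"
    by algebra
  finally show ?thesis by (simp only: H_dom_def H_rootless_def)
qed

text \<open>The only negative term of \<open>W_dom\<close>, \<open>- H_rootless t ^ m\<close>, is absorbed by one of the two copies
  of \<open>H_dom t ^ m\<close>. The other copy exceeds the \<open>m\<close>-th power of the binomial singled out in the
  preceding lemma, and the expansion of that power contains \<open>(8 ^ t * \<X>\<^sup>2) ^ j\<close> at least once.\<close>

lemma coeff_W_dom_even: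
  assumes "j \<le> m"
  shows "8 ^ (t * j) \<le> coeff (W_dom m t) (2 * j)"
proof -
  define y where "y = \<X>\<^sup>2 * ([:2:] ^ t) ^ 3"
  have nn_y: "nonneg_coeffs y" unfolding y_def by (intro nonneg_coeffs_intros; simp)
  have nn_1y: "nonneg_coeffs (1 + y)" by (intro nonneg_coeffs_intros nn_y)
  have 1: "nonneg_coeffs (H_dom t ^ m - H_rootless t ^ m)"
  proof (rule nonneg_coeffs_power_diff[OF nonneg_coeffs_H_rootless])
    have "nonneg_coeffs ((\<X> * L_near ^ t + L_dom ^ t) ^ 3)"
      by (intro nonneg_coeffs_intros nonneg_coeffs_L_F; simp)
    then show "nonneg_coeffs (H_dom t - H_rootless t)"
      by (simp only: H_dom_def add_diff_cancel_right')
  qed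
  have 2: "nonneg_coeffs (H_dom t ^ m - (1 + y) ^ m)"
    by (rule nonneg_coeffs_power_diff[OF nn_1y]) (simp only: y_def nonneg_coeffs_H_dom_minus)
  have "nonneg_coeffs ((1 + y) ^ (m - j) * ((1 + y) ^ j - y ^ j)
      + ((1 + y) ^ (m - j) - 1 ^ (m - j)) * y ^ j)"
    by (intro nonneg_coeffs_intros nonneg_coeffs_power_diff nn_y nn_1y)
      (simp_all add: nonneg_coeffs_const nn_y)
  also have "(1 + y) ^ (m - j) * ((1 + y) ^ j - y ^ j) + ((1 + y) ^ (m - j) - 1 ^ (m - j)) * y ^ j
      = (1 + y) ^ (m - j) * (1 + y) ^ j - y ^ j"
    by (simp add: algebra_simps)
  also have "(1 + y) ^ (m - j) * (1 + y) ^ j = (1 + y) ^ m"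
    using assms by (simp flip: power_add)
  finally have 3: "nonneg_coeffs ((1 + y) ^ m - y ^ j)" .
  have "nonneg_coeffs ((\<X> + 2) * (\<X> * H_near t ^ m) + \<X> * H_dom t ^ m
      + (H_dom t ^ m - H_rootless t ^ m)
      + (H_dom t ^ m - (1 + y) ^ m) + ((1 + y) ^ m - y ^ j))"
    by (intro nonneg_coeffs_add 1 2 3; intro nonneg_coeffs_intros nonneg_coeffs_H; simp)
  also have "(u + 2) * (u * k) + u * l + (l - n) + (l - w) + (w - z) = (u + 2) * (u * k + l) - n - z"
    for u k l n w z :: "real poly"
    by algebra
  finally have "nonneg_coeffs (W_dom m t - y ^ j)" by (simp only: W_dom_def)
  moreover have "y ^ j = monom (8 ^ (t * j)) (2 * j)"
  proof -
    have "(2::real) ^ (t * 3) = 8 ^ t" by (simp add: mult.commute[of t] power_mult)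
    then have "y = monom 1 2 * monom (8 ^ t) 0"
      by (simp add: y_def X_power monom_0 poly_const_pow flip: power_mult)
    then show ?thesis by (simp add: mult_monom monom_power power_mult)
  qed
  ultimately show ?thesis unfolding nonneg_coeffs_def by (auto dest!: spec[of _ "2 * j"])
qed

section \<open>Upper bounds for the odd coefficients\<close>

text \<open>In \<open>poly p z - poly p (- z)\<close> the even terms cancel and the odd ones are doubled, so
  all the terms that remain are nonnegative.\<close>

lemma odd_coeff_bound:
  assumes "nonneg_coeffs p" "0 \<le> z" "odd k"
  shows "2 * (coeff p k * z ^ k) \<le> poly p z - poly p (- z)"
proof -
  let ?f = "\<lambda>i. coeff p i * (z ^ i - (- z) ^ i)"
  have nn: "0 \<le> ?f i" for i
    using assms by (cases "even i") (auto simp: nonneg_coeffs_def)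
  have "2 * (coeff p k * z ^ k) = ?f k" using assms by simp
  also have "\<dots> \<le> (\<Sum>i\<le>degree p. ?f i)"
  proof (cases "k \<le> degree p")
    case True
    then show ?thesis using nn by (intro member_le_sum) auto
  next
    case False
    then have "coeff p k = 0" by (simp add: coeff_eq_0)
    then show ?thesis using nn by (simp add: sum_nonneg)
  qed
  also have "\<dots> = poly p z - poly p (- z)"
    by (simp add: poly_altdef right_diff_distrib sum_subtractf)
  finally show ?thesis .
qed

text \<open>The scale at which \<open>1\<close> and \<open>8 ^ t * z\<^sup>2\<close> balance; as its product with any power of
  \<open>t\<close> tends to \<open>0\<close>, in \<open>L_near ^ t\<close> and its companions only the constant coefficients matter.\<close>

definition scale :: "nat \<Rightarrow> real" where "scale t = 2 powr (- 3 / 2 * real t)"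

lemma scale_pos: "0 < scale t" by (simp add: scale_def)

lemma scale_square: "(scale t)\<^sup>2 = (2 powr (- real t)) ^ 3"
  by (simp add: scale_def powr_power)

lemma scale_square_times: "(scale t)\<^sup>2 * 8 ^ t = 1"
proof -
  have "(8::real) ^ t = 2 powr (3 * real t)"
    by (simp add: powr_realpow[symmetric] powr_powr[symmetric])
  then show ?thesis by (simp add: scale_def powr_power powr_add[symmetric])
qed

text \<open>That the limit is the same on both sides of \<open>0\<close> is what makes the odd coefficients
  negligible. It holds because \<open>H_near\<close>, \<open>H_dom\<close> and \<open>H_rootless\<close> depend on the sign of the
  argument only through terms that vanish in the limit and through the square \<open>\<X>\<^sup>2\<close>.\<close>

lemma poly_W_dom_tendsto:
  assumes s: "s = 1 \<or> s = (- 1 :: real)"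
  shows "(\<lambda>t. poly (W_dom m t) (s * scale t)) \<longlonglongrightarrow> 2 * 2 ^ m - 1"
proof -
  let ?z = "\<lambda>t. s * scale t" and ?c = "\<lambda>t. 2 powr (- real t)"
  have z0: "?z \<longlonglongrightarrow> 0"
    using s unfolding scale_def by (elim disjE; simp; real_asymp)
  have q: "(\<lambda>t. poly (L_dom ^ t) (?z t)) \<longlonglongrightarrow> 1"
    using s unfolding scale_def L_dom_def by (elim disjE; simp; real_asymp)
  have p0: "(\<lambda>t. ?z t * poly (L_near ^ t) (?z t)) \<longlonglongrightarrow> 0"
    using s unfolding scale_def L_near_def by (elim disjE; simp; real_asymp)
  have p: "(\<lambda>t. ?c t * poly (L_near ^ t) (?z t)) \<longlonglongrightarrow> 1"
    using s unfolding scale_def L_near_def by (elim disjE; simp; real_asymp)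
  have "(\<lambda>t. ?c t / ?z t * (poly (L_dom ^ t) (?z t) - poly (L_rootless ^ t) (?z t)))
      \<longlonglongrightarrow> 0"
    using s unfolding scale_def L_dom_def L_rootless_def by (elim disjE; simp; real_asymp)
  also have "(\<lambda>t. ?c t / ?z t * (poly (L_dom ^ t) (?z t) - poly (L_rootless ^ t) (?z t))) =
      (\<lambda>t. ?c t * poly (F_rootless t) (?z t))"
  proof
    fix t
    have "?z t * poly (F_rootless t) (?z t) = poly (L_dom ^ t) (?z t) - poly (L_rootless ^ t) (?z t)"
      using arg_cong[OF X_times_F_rootless[of t], of "\<lambda>p. poly p (?z t)"] by simp
    moreover have "c / y * (y * v) = c * v" if "y \<noteq> 0" for c y v :: real using that by simp
    moreover have "?z t \<noteq> 0" using s scale_pos[of t] by auto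
    ultimately show "?c t / ?z t * (poly (L_dom ^ t) (?z t) - poly (L_rootless ^ t) (?z t)) =
        ?c t * poly (F_rootless t) (?z t)"
      by metis
  qed
  finally have v: "(\<lambda>t. ?c t * poly (F_rootless t) (?z t)) \<longlonglongrightarrow> 0" .
  (* The square of the scale is a cube, which is split evenly among the three centres of H. *)
  have z2: "(?z t)\<^sup>2 = ?c t ^ 3" for t
    using s scale_square[of t] by (auto simp: power_mult_distrib)
  have k: "(\<lambda>t. poly ((\<X> * L_near ^ t + L_dom ^ t) ^ 3) (?z t)) \<longlonglongrightarrow> (0 + 1) ^ 3"
    using tendsto_power[OF tendsto_add[OF p0 q], of 3] by simp
  have d: "(\<lambda>t. poly (\<X>\<^sup>2 * (L_near ^ t + F_rootless t) ^ 3) (?z t)) \<longlonglongrightarrow> (1 + 0) ^ 3"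
    using tendsto_power[OF tendsto_add[OF p v], of 3]
    by (simp add: z2 flip: power_mult_distrib distrib_left)
  have e: "(\<lambda>t. poly (\<X>\<^sup>2 * F_rootless t ^ 3) (?z t)) \<longlonglongrightarrow> 0 ^ 3"
    using tendsto_power[OF v, of 3] by (simp add: z2 flip: power_mult_distrib)
  have bl: "(\<lambda>t. poly (H_rootless t) (?z t)) \<longlonglongrightarrow> 1"
    using tendsto_diff[OF d e] by (simp add: H_rootless_def right_diff_distrib)
  have gl: "(\<lambda>t. poly (H_dom t) (?z t)) \<longlonglongrightarrow> 2"
    using tendsto_add[OF k bl] by (simp add: H_dom_def)
  have hl: "(\<lambda>t. poly (H_near t) (?z t)) \<longlonglongrightarrow> 2"
    using tendsto_add[OF k d] by (simp add: H_near_def)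
  have "(\<lambda>t. (?z t + 2) * (?z t * poly (H_near t) (?z t) ^ m + poly (H_dom t) (?z t) ^ m)
      - poly (H_rootless t) (?z t) ^ m)
     \<longlonglongrightarrow> (0 + 2) * (0 * 2 ^ m + 2 ^ m) - 1 ^ m"
    by (intro tendsto_intros z0 bl gl hl)
  then show ?thesis by (simp add: W_dom_def)
qed

section \<open>Domination number and failures of log-concavity\<close>

lemma coeff_W_dom:
  "coeff (W_dom m t) i = real (dom_count (W m t) ((3 * t + 1) * m + 1 + i))"
proof -
  have "coeff (dominating_poly (W_tree m t)) (n + i) = coeff (W_dom m t) i"
    if "n = (3 * t + 1) * m + 1" for n
    unfolding poly_W_tree that by (simp add: X_power coeff_monom_mult)
  then show ?thesis using coeff_dominating_poly by metis
qed

lemma finite_dominating_sets: "finite {S. dominating_set (tree_graph T) S}"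
  using finite_families(2)[of T] by (simp add: dominating_set_tree_graph[abs_def])

text \<open>The constant coefficient of \<open>W_dom\<close> is positive, so the power of \<open>\<X>\<close> split off from the
  domination polynomial is the exact one.\<close>

lemma dom_number_W: "dom_number (W m t) = (3 * t + 1) * m + 1"
proof -
  let ?n = "(3 * t + 1) * m + 1"
  have fin: "finite {S. dominating_set (W m t) S}" by (rule finite_dominating_sets)
  have "coeff (W_dom m t) 0 \<ge> 1" using coeff_W_dom_even[of 0 m t] by simp
  then have "dom_count (W m t) ?n \<noteq> 0" by (simp add: coeff_W_dom)
  then obtain S where S: "dominating_set (W m t) S" "card S = ?n"
    unfolding dom_count_def by (metis (mono_tags, lifting) Collect_empty_eq card.empty)
  show ?thesis unfolding dom_number_def
  proof (rule Min_eqI)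
    show "finite (card ` {S. dominating_set (W m t) S})" using fin by simp
    show "?n \<in> card ` {S. dominating_set (W m t) S}" using S by force
  next
    fix k assume "k \<in> card ` {S. dominating_set (W m t) S}"
    then have "{S. dominating_set (W m t) S \<and> card S = k} \<noteq> {}" by auto
    moreover have "finite {S. dominating_set (W m t) S \<and> card S = k}" using fin by simp
    ultimately have "dom_count (W m t) k \<noteq> 0" by (simp add: dom_count_def)
    then have "coeff (dominating_poly (W_tree m t)) k \<noteq> 0" by (simp add: coeff_dominating_poly)
    then show "?n \<le> k"
      unfolding poly_W_tree X_power coeff_monom_mult by (metis not_le)
  qed
qed

lemma log_concavity_failure_W:
  assumes "j < m"
  shows "\<forall>\<^sub>F t in sequentially.
     (dom_count (W m t) (dom_number (W m t) + 2 * j + 1))\<^sup>2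
       < dom_count (W m t) (dom_number (W m t) + 2 * j)
         * dom_count (W m t) (dom_number (W m t) + 2 * j + 2)"
proof -
  have "(\<lambda>t. poly (W_dom m t) (1 * scale t) - poly (W_dom m t) (- 1 * scale t)) \<longlonglongrightarrow>
     (2 * 2 ^ m - 1) - (2 * 2 ^ m - 1)"
    by (intro tendsto_diff poly_W_dom_tendsto) auto
  then have "\<forall>\<^sub>F t in sequentially. poly (W_dom m t) (scale t) - poly (W_dom m t) (- scale t) < 2"
    by (intro order_tendstoD(2)[where y = 0]) simp_all
  then show ?thesis
  proof eventually_elim
    case (elim t)
    (* The weight z ^ i balances the powers of 2 ^ t: even terms up to index 2 m are at least 1. *)
    define z where "z = scale t"
    define a where "a i = coeff (W_dom m t) i * z ^ i" for i
    have z: "0 < z" by (simp add: z_def scale_pos)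
    have nn: "nonneg_coeffs (W_dom m t)" by (simp add: nonneg_coeffs_def coeff_W_dom)
    have "2 * a (2 * j + 1) < 2"
      using odd_coeff_bound[OF nn, of z "2 * j + 1"] z elim by (simp add: a_def z_def)
    moreover have "0 \<le> a (2 * j + 1)"
      using nn z by (simp add: a_def nonneg_coeffs_def)
    ultimately have odd: "(a (2 * j + 1))\<^sup>2 < 1" by (simp add: power_less_one_iff abs_square_less_1)
    have even: "1 \<le> a (2 * i)" if "i \<le> m" for i
    proof -
      have "1 = (z\<^sup>2 * 8 ^ t) ^ i" using scale_square_times[of t] by (simp add: z_def)
      also have "\<dots> = 8 ^ (t * i) * z ^ (2 * i)"
        by (simp only: power_mult_distrib power_mult mult.commute[of _ "(8 ^ t) ^ i"])
      also have "\<dots> \<le> a (2 * i)"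
        unfolding a_def using z by (intro mult_right_mono coeff_W_dom_even that) auto
      finally show ?thesis .
    qed
    have "1 * 1 \<le> a (2 * j) * a (2 * (j + 1))"
      using even[of j] even[of "j + 1"] assms by (intro mult_mono) auto
    with odd have "(a (2 * j + 1))\<^sup>2 < a (2 * j) * a (2 * j + 2)" by simp
    also have "a (2 * j) * a (2 * j + 2) =
        coeff (W_dom m t) (2 * j) * coeff (W_dom m t) (2 * j + 2) * z ^ (4 * j + 2)"
      by (simp add: a_def power_add[symmetric])
    also have "(a (2 * j + 1))\<^sup>2 = (coeff (W_dom m t) (2 * j + 1))\<^sup>2 * z ^ (4 * j + 2)"
    proof -
      have "(2 * j + 1) * 2 = 4 * j + 2" by simp
      then show ?thesis by (simp only: a_def power_mult_distrib power_mult[symmetric])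
    qed
    finally have "(coeff (W_dom m t) (2 * j + 1))\<^sup>2 <
        coeff (W_dom m t) (2 * j) * coeff (W_dom m t) (2 * j + 2)"
      using z by simp
    then show ?case
      unfolding coeff_W_dom dom_number_W add.assoc of_nat_mult[symmetric] of_nat_power[symmetric]
      by (simp only: of_nat_less_iff)
  qed
qed

lemma coeff_dom_poly: "coeff (dom_poly (tree_graph T)) s = int (dom_count (tree_graph T) s)"
proof -
  have "dom_count (tree_graph T) s = 0" if "s > card (tree_verts T)"
  proof -
    have "card S \<noteq> s" if "dominating_set (tree_graph T) S" for S
      using that \<open>s > _\<close> card_mono[OF finite_tree_verts, of S T]
      by (auto simp: dominating_set_def tree_graph_def)
    then have "{S. dominating_set (tree_graph T) S \<and> card S = s} = {}" by blast
    then show ?thesis by (simp only: dom_count_def card.empty)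
  qed
  then show ?thesis
    by (auto simp: dom_poly_def coeff_sum tree_graph_def)
qed

lemma dom_poly_from_dom_number:
  "dom_poly (tree_graph T) =
     (\<Sum>s = dom_number (tree_graph T)..card (verts (tree_graph T)).
        monom (int (dom_count (tree_graph T) s)) s)"
proof -
  let ?G = "tree_graph T"
  have "dom_count ?G s = 0" if "s < dom_number ?G" for s
  proof -
    have "card S \<noteq> s" if "dominating_set ?G S" for S
    proof -
      have "dom_number ?G \<le> card S"
        unfolding dom_number_def using that
        by (intro Min_le finite_imageI finite_dominating_sets) simp
      then show ?thesis using \<open>s < _\<close> by simp
    qed
    then have "{S. dominating_set (tree_graph T) S \<and> card S = s} = {}" by blast
    then show ?thesis by (simp only: dom_count_def card.empty)
  qed
  then show ?thesis
    unfolding dom_poly_def by (intro sum.mono_neutral_right) (auto simp: not_le)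
qed

text \<open>A failure at \<open>s\<close> needs a nonzero coefficient at \<open>s + 1\<close>. Finiteness is what allows the
  cardinality of the set of failures to be bounded from below by that of a subset.\<close>

lemma finite_lc_failures: "finite {s. lc_failure (coeff p) s}"
proof (rule finite_subset)
  show "{s. lc_failure (coeff p) s} \<subseteq> {..degree p}"
  proof
    fix s assume "s \<in> {s. lc_failure (coeff p) s}"
    then have "coeff p (s + 1) \<noteq> 0" by (auto simp: lc_failure_def)
    then show "s \<in> {..degree p}" using le_degree by fastforce
  qed
qed simp

theorem theorem4p10:
  fixes m :: nat
  assumes "m \<ge> 1"
  shows "(\<forall>\<^sub>F t in sequentially. card {s. lc_failure (coeff (dom_poly (W m t))) s} \<ge> m)
    \<and> (\<forall>t\<ge>1. dom_poly (W m t) =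
          (\<Sum>s = dom_number (W m t)..card (verts (W m t)). monom (int (dom_count (W m t) s)) s))
    \<and> (\<forall>j<m. \<forall>\<^sub>F t in sequentially.
          (dom_count (W m t) (dom_number (W m t) + 2 * j + 1))\<^sup>2
            < dom_count (W m t) (dom_number (W m t) + 2 * j)
              * dom_count (W m t) (dom_number (W m t) + 2 * j + 2))"
proof (intro conjI allI impI)
  have "\<forall>\<^sub>F t in sequentially. \<forall>j\<in>{..<m}.
     (dom_count (W m t) (dom_number (W m t) + 2 * j + 1))\<^sup>2
       < dom_count (W m t) (dom_number (W m t) + 2 * j)
         * dom_count (W m t) (dom_number (W m t) + 2 * j + 2)"
    by (intro eventually_ball_finite ballI log_concavity_failure_W) auto
  then show "\<forall>\<^sub>F t in sequentially. card {s. lc_failure (coeff (dom_poly (W m t))) s} \<ge> m"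
  proof eventually_elim
    case (elim t)
    let ?f = "\<lambda>j. dom_number (W m t) + 2 * j + 1"
    have "?f ` {..<m} \<subseteq> {s. lc_failure (coeff (dom_poly (W m t))) s}"
    proof
      fix s assume "s \<in> ?f ` {..<m}"
      then obtain j where j: "j < m" "s = ?f j" by blast
      have "int ((dom_count (W m t) s)\<^sup>2) < int (dom_count (W m t) (s - 1) * dom_count (W m t) (s + 1))"
        using elim j by (simp only: of_nat_less_iff) simp
      then show "s \<in> {s. lc_failure (coeff (dom_poly (W m t))) s}"
        using j by (simp add: lc_failure_def coeff_dom_poly)
    qed
    then have "card (?f ` {..<m}) \<le> card {s. lc_failure (coeff (dom_poly (W m t))) s}"
      by (rule card_mono[OF finite_lc_failures])
    then show ?case by (simp add: card_image inj_on_def)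
  qed
next
  fix t :: nat
  show "dom_poly (W m t) =
      (\<Sum>s = dom_number (W m t)..card (verts (W m t)). monom (int (dom_count (W m t) s)) s)"
    by (rule dom_poly_from_dom_number)
next
  fix j assume "j < m"
  then show "\<forall>\<^sub>F t in sequentially.
      (dom_count (W m t) (dom_number (W m t) + 2 * j + 1))\<^sup>2
        < dom_count (W m t) (dom_number (W m t) + 2 * j)
         * dom_count (W m t) (dom_number (W m t) + 2 * j + 2)"
    by (rule log_concavity_failure_W)
qed

end
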